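(* Let $\chi(\mathbb{R}^d)$ denote the chromatic number of the unit-distance graph on $\mathbb{R}^d$, i.e. the graph whose vertex set is $\mathbb{R}^d$ and in which two points $p,q$ are adjacent if and only if their Euclidean distance is exactly $1$. Then $\chi(\mathbb{R}^8) \ge 19$, $\chi(\mathbb{R}^9) \ge 21$, $\chi(\mathbb{R}^{10}) \ge 26$, $\chi(\mathbb{R}^{11}) \ge 32$, and $\chi(\mathbb{R}^{12}) \ge 32$.
   Context: The chromatic number $\chi(G)$ of a graph $G$ is the smallest integer $k$ such that there is a function $f: V(G) \to \{1,\dots,k\}$ with $f(p) \neq f(q)$ whenever $p$ and $q$ are adjacent. Here the graph $\mathbb{R}^d$ is the infinite graph on all points of $d$-dimensional Euclidean space, with edges between points at Euclidean distance exactly $1$. *)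

theory Defs
  imports "HOL-Analysis.Analysis" "HOL-Library.Extended_Nat" "HOL-Library.Numeral_Type"
begin

definition proper_coloring :: "'a set \<Rightarrow> ('a \<Rightarrow> 'a \<Rightarrow> bool) \<Rightarrow> nat \<Rightarrow> ('a \<Rightarrow> nat) \<Rightarrow> bool" where
  "proper_coloring V adj k f \<longleftrightarrow>
     (\<forall>p\<in>V. f p \<in> {1..k}) \<and> (\<forall>p\<in>V. \<forall>q\<in>V. adj p q \<longrightarrow> f p \<noteq> f q)"

text \<open>The infimum is taken in \<^typ>\<open>enat\<close>: it is the least admissible number of colours if
  there is one, and \<^term>\<open>\<infinity> :: enat\<close> if the graph has no finite proper colouring.\<close>

definition chromatic_number :: "'a set \<Rightarrow> ('a \<Rightarrow> 'a \<Rightarrow> bool) \<Rightarrow> enat" where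
  "chromatic_number V adj = Inf {enat k |k. \<exists>f. proper_coloring V adj k f}"

definition unit_distance :: "'a::metric_space \<Rightarrow> 'a \<Rightarrow> bool" where
  "unit_distance p q \<longleftrightarrow> dist p q = 1"

lemma chromatic_number_eq_enat_iff:
  "chromatic_number V adj = enat k \<longleftrightarrow>
     (\<exists>f. proper_coloring V adj k f) \<and> (\<forall>j<k. \<nexists>f. proper_coloring V adj j f)"
proof -
  define S where "S = {enat k |k. \<exists>f. proper_coloring V adj k f}"
  have S: "enat j \<in> S \<longleftrightarrow> (\<exists>f. proper_coloring V adj j f)" for j
    by (auto simp: S_def)
  have "Inf S = enat k \<longleftrightarrow> enat k \<in> S \<and> (\<forall>j<k. enat j \<notin> S)"
  proof
    assume *: "Inf S = enat k"
    then have "S \<noteq> {}" by (auto simp: Inf_enat_def)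
    then have "Inf S \<in> S"
      unfolding Inf_enat_def by (auto intro: LeastI)
    moreover have "enat j \<notin> S" if "j < k" for j
      using that * Inf_lower[of "enat j" S] by auto
    ultimately show "enat k \<in> S \<and> (\<forall>j<k. enat j \<notin> S)"
      using * by simp
  next
    assume *: "enat k \<in> S \<and> (\<forall>j<k. enat j \<notin> S)"
    show "Inf S = enat k"
    proof (rule antisym)
      show "Inf S \<le> enat k" using * by (auto intro: Inf_lower)
      show "enat k \<le> Inf S"
      proof (rule Inf_greatest)
        fix x assume "x \<in> S"
        then obtain j where "x = enat j" by (auto simp: S_def)
        with * \<open>x \<in> S\<close> show "enat k \<le> x" by (metis enat_ord_simps(1) not_le)
      qed
    qed
  qed
  then show ?thesis by (simp add: S chromatic_number_def flip: S_def)
qed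

end

theory Submission
  imports Defs
begin

text \<open>
  A Hoffman-type spectral bound for the Cayley graph on \<open>\<int>\<^sup>n\<close> whose edges join points at
  squared distance \<open>8\<close>. Put weights \<open>A\<close>, \<open>B\<close>, \<open>C\<close> on the difference vectors of shape
  \<open>(1\<^sup>8)\<close>, \<open>(2, 1\<^sup>4)\<close>, \<open>(2, 2)\<close> (up to signs and padding by zeros). If the resulting sum of products
  of cosines is at least \<open>-K\<close> at every character \<open>\<theta>\<close>, and the total weight is \<open>W\<close>,
  then every proper colouring needs at least \<open>1 + W / K\<close> colours.

  The character sum is affine in each of the pairs \<open>(cos \<theta>\<^sub>i, cos (2 \<theta>\<^sub>i))\<close>. These lie on
  a parabola arc, hence in a pentagon around it, so it suffices to bound the sum when every pair
  is a vertex of the pentagon, and by symmetry only the multiset of vertices matters.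
  Dimension \<open>8\<close> yields \<open>21\<close> colours and dimension \<open>10\<close> yields \<open>32\<close>; both pass to higher dimensions.
\<close>

section \<open>Spectral bound\<close>

lemma sum_cis_multiples_eq_0:
  fixes m :: int
  assumes "m \<noteq> 0" "\<bar>m\<bar> < int P"
  shows "(\<Sum>j<P. cis (2 * pi / real P * real j * of_int m)) = 0"
proof -
  define z where "z = cis (2 * pi * of_int m / real P)"
  have P: "real P > 0"
    using assms by linarith
  have "z \<noteq> 1"
  proof
    assume "z = 1"
    then have "cos (2 * pi * of_int m / real P) = 1"
      by (simp add: z_def complex_eq_iff)
    then obtain i :: int where "2 * pi * of_int m / real P = of_int i * 2 * pi"
      using cos_one_2pi_int by blast
    then have "of_int m = real_of_int i * real P"
      using P by (simp add: field_simps)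
    then have "m = i * int P"
      by (metis of_int_eq_iff of_int_mult of_int_of_nat_eq)
    then show False
      using assms by (auto simp: abs_mult dest: zdvd_imp_le[rotated])
  qed
  moreover have "z ^ P = 1"
  proof -
    have "real P * (2 * pi * of_int m / real P) = 2 * pi * of_int m"
      using P by simp
    then have "z ^ P = cis (2 * pi * of_int m)"
      by (metis z_def Complex.DeMoivre)
    then show ?thesis
      by (simp add: complex_eq_iff cos_int_2pin sin_int_2pin)
  qed
  moreover have "cis (2 * pi / real P * real j * of_int m) = z ^ j" for j
    by (simp add: z_def Complex.DeMoivre algebra_simps)
  ultimately show ?thesis
    by (simp add: geometric_sum)
qed

text \<open>Product-to-sum leaves the frequencies \<open>d + s\<close> and \<open>d - s\<close>.
  Both are nonzero and at most \<open>M + 1\<close> in absolute value, hence nonzero modulo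
  \<open>M + 2\<close>.\<close>

lemma sum_cos_cis_eq_0:
  fixes d :: int
  assumes "\<bar>d\<bar> < int M" "s \<le> 2" "\<bar>d\<bar> \<noteq> int s" "P = M + 2"
  shows "(\<Sum>j<P. complex_of_real (cos (real s * (2 * pi / real P * real j)))
           * cis (2 * pi / real P * real j * of_int d)) = 0" (is "(\<Sum>j<P. ?f j) = 0")
proof -
  have cos_cis: "complex_of_real (cos a) * cis b = (cis (b + a) + cis (b - a)) / 2" for a b
    by (simp add: complex_eq_iff cos_add cos_diff sin_add sin_diff)
  have "?f j = (cis (2 * pi / real P * real j * of_int (d + int s))
      + cis (2 * pi / real P * real j * of_int (d - int s))) / 2" for j
    unfolding cos_cis by (simp add: algebra_simps add_divide_distrib diff_divide_distrib)
  then have "(\<Sum>j<P. ?f j) = ((\<Sum>j<P. cis (2 * pi / real P * real j * of_int (d + int s)))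
      + (\<Sum>j<P. cis (2 * pi / real P * real j * of_int (d - int s)))) / 2"
    by (simp only: sum.distrib sum_divide_distrib[symmetric])
  also have "\<dots> = 0"
    using assms by (subst (1 2) sum_cis_multiples_eq_0) auto
  finally show ?thesis .
qed

text \<open>A box of side \<open>M\<close> is placed in the torus of side \<open>M + 2\<close>, where differences with entries
  at most \<open>2\<close> do not wrap around. Keeping only the trivial character in the Fourier expansion
  then avoids counting the pairs at a given difference inside the box.\<close>

lemma spectral_colouring_bound:
  fixes s :: "'i \<Rightarrow> nat \<Rightarrow> nat" and w :: "'i \<Rightarrow> real" and col :: "(nat \<Rightarrow> int) \<Rightarrow> nat"
  assumes "finite I" "M > 0"
    and s: "\<And>i l. i \<in> I \<Longrightarrow> l < n \<Longrightarrow> s i l \<le> 2"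
    and col: "\<And>x. col x \<in> {1..k}"
    and proper: "\<And>i x y. i \<in> I \<Longrightarrow> (\<And>l. l < n \<Longrightarrow> \<bar>x l - y l\<bar> = int (s i l)) \<Longrightarrow> col x \<noteq> col y"
    and pos: "\<And>\<theta>. 0 \<le> \<mu> + (\<Sum>i\<in>I. w i * (\<Prod>l<n. cos (real (s i l) * \<theta> l)))"
  shows "(\<mu> + (\<Sum>i\<in>I. w i)) * real M ^ n \<le> real k * \<mu> * real (M + 2) ^ n"
proof -
  define P where "P = M + 2"
  define ph where "ph = (\<lambda>j. 2 * pi / real P * real j)"
  define T where "T = PiE {..<n} (\<lambda>_. {..<P})"
  define B where "B = PiE {..<n} (\<lambda>_. {0..<int M})"
  define G where "G j = \<mu> + (\<Sum>i\<in>I. w i * (\<Prod>l<n. cos (real (s i l) * ph (j l))))" for j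
  define S where "S c = {x \<in> B. col x = c}" for c
  define Z where "Z c j = (\<Sum>x\<in>S c. \<Prod>l<n. cis (ph (j l) * of_int (x l)))" for c j
  \<comment> \<open>Spectral energy of the colour classes weighted by \<open>G\<close>: computed
    exactly by orthogonality, then bounded below by its term at the trivial character
    \<open>j0\<close> and Cauchy-Schwarz.\<close>
  define X where "X = (\<Sum>j\<in>T. G j * (\<Sum>c\<in>{1..k}. (cmod (Z c j))\<^sup>2))"
  have finT: "finite T" and finB: "finite B"
    by (auto simp: T_def B_def intro!: finite_PiE)
  have cardT: "card T = P ^ n" and cardB: "card B = M ^ n"
    by (simp_all add: T_def B_def card_PiE)
  have finS: "finite (S c)" for c
    using finB by (simp add: S_def)
  have SB: "(\<Sum>c\<in>{1..k}. card (S c)) = M ^ n"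
  proof -
    have "(\<Sum>c\<in>{1..k}. card (S c)) = card (\<Union>c\<in>{1..k}. S c)"
      using finS by (subst card_UN_disjoint) (auto simp: S_def)
    also have "(\<Union>c\<in>{1..k}. S c) = B"
      using col by (auto simp: S_def)
    finally show ?thesis
      by (simp add: cardB)
  qed
  have "X = \<mu> * real P ^ n * real M ^ n"
  proof -
    have orth: "(\<Sum>j\<in>T. of_real (\<Prod>l<n. cos (real (t l) * ph (j l)))
        * (\<Prod>l<n. cis (ph (j l) * of_int (x l - y l)))) = (0 :: complex)"
      if xy: "x \<in> B" "y \<in> B" and t: "\<And>l. l < n \<Longrightarrow> t l \<le> 2" and ne: "\<not> (\<forall>l<n. \<bar>x l - y l\<bar> = int (t l))"
      for t :: "nat \<Rightarrow> nat" and x y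
    proof -
      obtain l where l: "l < n" "\<bar>x l - y l\<bar> \<noteq> int (t l)"
        using ne by blast
      have "x l \<in> {0..<int M}" "y l \<in> {0..<int M}"
        using xy l by (auto simp: B_def PiE_iff)
      then have "\<bar>x l - y l\<bar> < int M"
        by auto
      then have "(\<Sum>j<P. complex_of_real (cos (real (t l) * ph j)) * cis (ph j * of_int (x l - y l))) = 0"
        unfolding ph_def using l t by (intro sum_cos_cis_eq_0) (auto simp: P_def)
      then have "(\<Prod>l<n. \<Sum>j<P. complex_of_real (cos (real (t l) * ph j)) * cis (ph j * of_int (x l - y l))) = 0"
        using l by (auto intro: prod_zero)
      then show ?thesis
        by (subst (asm) prod_sum_PiE) (auto simp: T_def prod.distrib)
    qed
    have ZZ: "complex_of_real ((cmod (Z c j))\<^sup>2)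
        = (\<Sum>x\<in>S c. \<Sum>y\<in>S c. \<Prod>l<n. cis (ph (j l) * of_int (x l - y l)))" for c j
    proof -
      have "complex_of_real ((cmod (Z c j))\<^sup>2) = Z c j * cnj (Z c j)"
        by (rule complex_norm_square)
      then show ?thesis
        by (simp add: Z_def cis_cnj sum_product cis_mult prod.distrib[symmetric] algebra_simps)
    qed
    have pair: "(\<Sum>j\<in>T. of_real (G j) * (\<Prod>l<n. cis (ph (j l) * of_int (x l - y l))))
        = (if x = y then of_real (\<mu> * real P ^ n) else 0 :: complex)"
      if xy: "x \<in> S c" "y \<in> S c" for c x y
    proof -
      have xyB: "x \<in> B" "y \<in> B" and "col x = col y"
        using xy by (auto simp: S_def)
      \<comment> \<open>Equal colours rule out, by properness, every difference of shape
        \<open>s i\<close>, so only the constant \<mu> of \<open>G\<close> survives.\<close>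
      have 1: "(\<Sum>j\<in>T. of_real (\<Prod>l<n. cos (real (s i l) * ph (j l)))
          * (\<Prod>l<n. cis (ph (j l) * of_int (x l - y l)))) = (0 :: complex)" if "i \<in> I" for i
        using proper[OF that] s[OF that] \<open>col x = col y\<close> by (intro orth xyB) blast+
      have 2: "(\<Sum>j\<in>T. (\<Prod>l<n. cis (ph (j l) * of_int (x l - y l)))) = (if x = y then of_nat (P ^ n) else 0)"
      proof (cases "x = y")
        case False
        then obtain l where "l < n" "x l \<noteq> y l"
          using xyB by (metis B_def PiE_ext lessThan_iff)
        then show ?thesis
          using orth[OF xyB, of "\<lambda>_. 0"] False by auto
      qed (simp add: cardT)
      have "(\<Sum>j\<in>T. of_real (G j) * (\<Prod>l<n. cis (ph (j l) * of_int (x l - y l))))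
          = of_real \<mu> * (\<Sum>j\<in>T. (\<Prod>l<n. cis (ph (j l) * of_int (x l - y l))))
            + (\<Sum>i\<in>I. of_real (w i) * (\<Sum>j\<in>T. of_real (\<Prod>l<n. cos (real (s i l) * ph (j l)))
          * (\<Prod>l<n. cis (ph (j l) * of_int (x l - y l)))))"
        unfolding G_def of_real_add of_real_sum of_real_mult distrib_right sum.distrib
          sum_distrib_left sum_distrib_right
        by (subst (2) sum.swap) (simp add: mult.assoc)
      then show ?thesis
        using 1 2 by simp
    qed
    have "complex_of_real X
        = (\<Sum>j\<in>T. of_real (G j) * (\<Sum>c\<in>{1..k}. \<Sum>x\<in>S c. \<Sum>y\<in>S c. \<Prod>l<n. cis (ph (j l) * of_int (x l - y l))))"
      unfolding X_def of_real_sum of_real_mult ZZ ..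
    also have "\<dots> = (\<Sum>c\<in>{1..k}. \<Sum>x\<in>S c. \<Sum>y\<in>S c. \<Sum>j\<in>T. of_real (G j) * (\<Prod>l<n. cis (ph (j l) * of_int (x l - y l))))"
      unfolding sum_distrib_left
      by (subst sum.swap, intro sum.cong refl, subst sum.swap, intro sum.cong refl, subst sum.swap, rule refl)
    also have "\<dots> = (\<Sum>c\<in>{1..k}. \<Sum>x\<in>S c. \<Sum>y\<in>S c. if x = y then of_real (\<mu> * real P ^ n) else 0)"
      by (intro sum.cong refl pair)
    also have "\<dots> = (\<Sum>c\<in>{1..k}. of_nat (card (S c)) * of_real (\<mu> * real P ^ n))"
      using finS by simp
    also have "\<dots> = of_nat (\<Sum>c\<in>{1..k}. card (S c)) * of_real (\<mu> * real P ^ n)"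
      by (simp add: sum_distrib_right)
    also have "\<dots> = complex_of_real (\<mu> * real P ^ n * real M ^ n)"
      unfolding SB by simp
    finally show ?thesis
      by (simp only: of_real_eq_iff)
  qed
  moreover have "(\<mu> + (\<Sum>i\<in>I. w i)) * (real M ^ n)\<^sup>2 \<le> real k * X"
  proof -
    define j0 where "j0 = (\<lambda>l\<in>{..<n}. 0 :: nat)"
    have j0: "j0 \<in> T"
      by (auto simp: j0_def T_def P_def)
    have G0: "G j0 = \<mu> + (\<Sum>i\<in>I. w i)"
      by (simp add: G_def j0_def ph_def)
    have Z0: "Z c j0 = of_nat (card (S c))" for c
      by (simp add: Z_def j0_def ph_def)
    have Gpos: "G j \<ge> 0" for j
      unfolding G_def by (rule pos)
    have "G j0 * (\<Sum>c\<in>{1..k}. (cmod (Z c j0))\<^sup>2) \<le> X"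
      unfolding X_def
      by (rule member_le_sum[OF j0]) (auto intro!: mult_nonneg_nonneg sum_nonneg Gpos finT)
    then have X: "G j0 * (\<Sum>c\<in>{1..k}. (real (card (S c)))\<^sup>2) \<le> X"
      by (simp add: Z0)
    have "(real M ^ n)\<^sup>2 = (\<Sum>c\<in>{1..k}. real (card (S c)))\<^sup>2"
      using SB by (metis of_nat_power of_nat_sum)
    also have "\<dots> \<le> real k * (\<Sum>c\<in>{1..k}. (real (card (S c)))\<^sup>2)"
      using sum_squared_le_sum_of_squares[of "\<lambda>c. real (card (S c))" "{1..k}"] by (simp add: mult.commute)
    finally have "G j0 * (real M ^ n)\<^sup>2 \<le> G j0 * (real k * (\<Sum>c\<in>{1..k}. (real (card (S c)))\<^sup>2))"
      by (intro mult_left_mono Gpos)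
    also have "\<dots> \<le> real k * X"
      using X by (subst mult.left_commute) (rule mult_left_mono, auto)
    finally show ?thesis
      by (simp add: G0)
  qed
  ultimately have "((\<mu> + (\<Sum>i\<in>I. w i)) * real M ^ n) * real M ^ n \<le> (real k * \<mu> * real (M + 2) ^ n) * real M ^ n"
    by (simp add: P_def power2_eq_square mult_ac)
  then show ?thesis
    using \<open>M > 0\<close> by (subst (asm) mult_le_cancel_right_pos) simp_all
qed

section \<open>Character sums as multi-affine functions\<close>

text \<open>The coefficient of \<open>s\<^sup>a t\<^sup>b\<close> in the product of \<open>1 + s c + t y\<close> over the pairs \<open>(c, y)\<close>.\<close>

fun mixed_esym :: "nat \<Rightarrow> nat \<Rightarrow> ('a::comm_ring_1 \<times> 'a) list \<Rightarrow> 'a" where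
  "mixed_esym a b [] = (if a = 0 \<and> b = 0 then 1 else 0)"
| "mixed_esym a b (p # ps) = mixed_esym a b ps
     + (case a of 0 \<Rightarrow> 0 | Suc a' \<Rightarrow> fst p * mixed_esym a' b ps)
     + (case b of 0 \<Rightarrow> 0 | Suc b' \<Rightarrow> snd p * mixed_esym a b' ps)"

lemma mixed_esym_move_to_front:
  "mixed_esym a b (ps @ p # qs) = mixed_esym a b (p # ps @ qs)"
proof (induction ps arbitrary: a b)
  case (Cons x ps)
  show ?case
    by (simp add: Cons.IH algebra_simps split: nat.split)
qed simp

lemma mixed_esym_scale:
  "mixed_esym a b (map (\<lambda>(c, y). (of_int c / r, of_int y / t)) vs)
     = of_int (mixed_esym a b vs) / (r ^ a * t ^ b :: real)"
  if "r \<noteq> 0" "t \<noteq> 0"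
proof (induction vs arbitrary: a b)
  case (Cons v vs)
  show ?case
    using that by (cases v) (auto simp: Cons.IH field_simps split: nat.split)
qed simp

text \<open>Signs are dropped because a product of cosines averages the character over all sign
  choices.\<close>

fun shapes :: "nat \<Rightarrow> nat \<Rightarrow> nat \<Rightarrow> nat list list" where
  "shapes a b 0 = (if a = 0 \<and> b = 0 then [[]] else [])"
| "shapes a b (Suc n) = map (Cons 0) (shapes a b n)
     @ (case a of 0 \<Rightarrow> [] | Suc a' \<Rightarrow> map (Cons 1) (shapes a' b n))
     @ (case b of 0 \<Rightarrow> [] | Suc b' \<Rightarrow> map (Cons 2) (shapes a b' n))"

lemma shapes_props:
  "t \<in> set (shapes a b n) \<Longrightarrow> length t = n \<and> set t \<subseteq> {0, 1, 2} \<and> (\<Sum>l<n. (t ! l)\<^sup>2) = a + 4 * b"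
proof (induction n arbitrary: a b t)
  case (Suc n)
  show ?case
    using Suc.prems
    by (auto simp: sum.lessThan_Suc_shift simp del: sum.lessThan_Suc split: nat.splits dest!: Suc.IH)
qed (auto split: if_splits)

lemma sum_shapes_prod_cos:
  "(\<Sum>t\<leftarrow>shapes a b n. \<Prod>l<n. cos (real (t ! l) * \<theta> l))
     = mixed_esym a b (map (\<lambda>l. (cos (\<theta> l), cos (2 * \<theta> l))) [0..<n])"
proof (induction n arbitrary: a b \<theta>)
  case (Suc n)
  have upt: "map f [0..<Suc n] = f 0 # map (\<lambda>l. f (Suc l)) [0..<n]" for f :: "nat \<Rightarrow> real \<times> real"
    by (simp add: upt_conv_Cons map_Suc_upt[symmetric] del: upt_Suc)
  show ?case
    unfolding upt
    by (simp add: Suc.IH[where \<theta> = "\<lambda>l. \<theta> (Suc l)"] prod.lessThan_Suc_shift comp_def sum_list_const_mult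
      del: prod.lessThan_Suc split: nat.split)
qed simp

text \<open>The pentagon is bounded by the chord \<open>y = 1\<close> of the parabola \<open>y = 2 c\<^sup>2 - 1\<close> and by its
  tangents at \<open>\<plusminus>1\<close> and \<open>\<plusminus>1/3\<close>; its vertices are stored as integers \<open>(3 c, 9 y)\<close>.\<close>

definition pentagon :: "(int \<times> int) list" where
  "pentagon = [(3, 9), (-3, 9), (2, -3), (-2, -3), (0, -11)]"

abbreviation descale :: "int \<times> int \<Rightarrow> real \<times> real" where
  "descale \<equiv> \<lambda>(c, y). (of_int c / 3, of_int y / 9)"

text \<open>For \<open>r \<le> 0\<close> the chord lies below the graph. For \<open>r > 0\<close>
  and \<open>c \<ge> 0\<close>, interpolating between neighbouring vertices gives the tangent at 1/3
  or 1, and the remainder is \<open>2 * r\<close> times a square. Reflection covers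
  \<open>c < 0\<close>.\<close>

lemma affine_nonneg_on_parabola:
  fixes p q r c :: real
  assumes v: "\<And>v. v \<in> descale ` set pentagon \<Longrightarrow> 0 \<le> p + q * fst v + r * snd v"
    and c: "\<bar>c\<bar> \<le> 1"
  shows "0 \<le> p + q * c + r * (2 * c\<^sup>2 - 1)"
proof -
  have v: "0 \<le> p + q + r" "0 \<le> p - q + r" "0 \<le> p + q * (2 / 3) - r / 3"
      "0 \<le> p - q * (2 / 3) - r / 3" "0 \<le> p - r * (11 / 9)"
    using v[of "(1, 1)"] v[of "(-1, 1)"] v[of "(2/3, -1/3)"] v[of "(-2/3, -1/3)"] v[of "(0, -11/9)"]
    by (simp_all add: pentagon_def)
  have pos: "0 \<le> p + q * c + r * (2 * c\<^sup>2 - 1)"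
    if c: "0 \<le> c" "c \<le> 1" and v: "0 \<le> p + q + r" "0 \<le> p - q + r" "0 \<le> p + q * (2 / 3) - r / 3" "0 \<le> p - r * (11 / 9)"
    for q c
  proof (cases "r \<le> 0")
    case True
    have "0 \<le> (1 + c) / 2 * (p + q + r) + (1 - c) / 2 * (p - q + r)"
      by (rule add_nonneg_nonneg; rule mult_nonneg_nonneg) (use v c in auto)
    also have "\<dots> = p + q * c + r"
      by (simp add: field_simps)
    also have "\<dots> \<le> p + q * c + r * (2 * c\<^sup>2 - 1)"
      using True c by (simp add: mult_le_cancel_left1 algebra_simps power_le_one)
    finally show ?thesis .
  next
    case False
    show ?thesis
    proof (cases "c \<le> 2 / 3")
      case True
      have "0 \<le> (1 - 3 / 2 * c) * (p - r * (11 / 9)) + 3 / 2 * c * (p + q * (2 / 3) - r / 3) + 2 * r * (c - 1 / 3)\<^sup>2"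
        by (rule add_nonneg_nonneg, rule add_nonneg_nonneg; rule mult_nonneg_nonneg) (use v c True False in auto)
      also have "\<dots> = p + q * c + r * (2 * c\<^sup>2 - 1)"
        by (simp add: field_simps power2_eq_square)
      finally show ?thesis .
    next
      case c': False
      have "0 \<le> (3 * c - 2) * (p + q + r) + (3 - 3 * c) * (p + q * (2 / 3) - r / 3) + 2 * r * (c - 1)\<^sup>2"
        by (rule add_nonneg_nonneg, rule add_nonneg_nonneg; rule mult_nonneg_nonneg) (use v c c' False in auto)
      also have "\<dots> = p + q * c + r * (2 * c\<^sup>2 - 1)"
        by (simp add: field_simps power2_eq_square)
      finally show ?thesis .
    qed
  qed
  show ?thesis
    using pos[of c q] pos[of "-c" "-q"] v c by (cases "0 \<le> c") auto
qed

text \<open>The index pairs are the solutions of a + 4 b = 8, the squared length.\<close>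

definition energy :: "'a \<times> 'a \<times> 'a \<times> 'a \<Rightarrow> ('a::comm_ring_1 \<times> 'a) list \<Rightarrow> 'a" where
  "energy = (\<lambda>(A, B, C, K) ps. A * mixed_esym 8 0 ps + B * mixed_esym 4 1 ps + C * mixed_esym 0 2 ps + K)"

text \<open>Each coordinate of a shape has a single entry 0, 1 or 2, so a pair never contributes the
  product of its two components.\<close>

lemma energy_affine: "\<exists>p q r. \<forall>v. energy W (ps @ v # qs) = p + q * fst v + r * snd v"
proof -
  obtain A B C K where W: "W = (A, B, C, K)"
    by (cases W)
  show ?thesis
    unfolding W
    by (rule exI[of _ "energy (A, B, C, K) (ps @ qs)"],
        rule exI[of _ "A * mixed_esym 7 0 (ps @ qs) + B * mixed_esym 3 1 (ps @ qs)"],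
        rule exI[of _ "B * mixed_esym 4 0 (ps @ qs) + C * mixed_esym 0 1 (ps @ qs)"])
      (simp add: energy_def mixed_esym_move_to_front eval_nat_numeral algebra_simps)
qed

text \<open>Parabola points are traded for vertices one at a time; \<open>ps\<close> holds the
  vertices already chosen.\<close>

lemma energy_nonneg_on_parabola:
  fixes W :: "real \<times> real \<times> real \<times> real"
  assumes "\<And>vs. set vs \<subseteq> descale ` set pentagon \<Longrightarrow> length vs = n \<Longrightarrow> 0 \<le> energy W vs"
    and "set ps \<subseteq> descale ` set pentagon"
    and "\<And>x. x \<in> set cs \<Longrightarrow> \<bar>x\<bar> \<le> 1" and "length ps + length cs = n"
  shows "0 \<le> energy W (ps @ map (\<lambda>c. (c, 2 * c\<^sup>2 - 1)) cs)"
  using assms(2-)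
proof (induction cs arbitrary: ps)
  case Nil
  then show ?case
    using assms(1)[of ps] by simp
next
  case (Cons c cs)
  let ?qs = "map (\<lambda>c. (c, 2 * c\<^sup>2 - 1)) cs"
  obtain p q r where pqr: "\<And>v. energy W (ps @ v # ?qs) = p + q * fst v + r * snd v"
    using energy_affine by metis
  have "0 \<le> p + q * fst v + r * snd v" if "v \<in> descale ` set pentagon" for v
    using Cons.IH[of "ps @ [v]"] Cons.prems that by (simp add: pqr[symmetric])
  then have "0 \<le> p + q * c + r * (2 * c\<^sup>2 - 1)"
    using Cons.prems by (intro affine_nonneg_on_parabola) auto
  then show ?case
    by (simp add: pqr)
qed

section \<open>Evaluation at the vertices\<close>

text \<open>The values of \<open>mixed_esym\<close> are updated incrementally, since its defining recursion takes
  exponential time.\<close>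

fun shift_add :: "int \<Rightarrow> int \<Rightarrow> int list \<Rightarrow> int list" where
  "shift_add c p [] = []"
| "shift_add c p (x # xs) = (x + c * p) # shift_add c x xs"

text \<open>These indices contain the three used by \<open>energy\<close> and are closed under the
  recursion of \<open>mixed_esym\<close>.\<close>

definition table :: "(int \<times> int) list \<Rightarrow> int list \<times> int list \<times> int" where
  "table vs = (map (\<lambda>a. mixed_esym a 0 vs) [0..<9], map (\<lambda>a. mixed_esym a 1 vs) [0..<5], mixed_esym 0 2 vs)"

fun table_step :: "int \<times> int \<Rightarrow> int list \<times> int list \<times> int \<Rightarrow> int list \<times> int list \<times> int" where
  "table_step (c, y) (r0, r1, e)
     = (shift_add c 0 r0, map2 (\<lambda>x z. x + y * z) (shift_add c 0 r1) r0, e + y * hd r1)"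

fun table_energy :: "int \<times> int \<times> int \<times> int \<Rightarrow> int list \<times> int list \<times> int \<Rightarrow> int" where
  "table_energy (A, B, C, K) (r0, r1, e) = A * last r0 + B * last r1 + C * e + K"

lemma table_Cons: "table (v # vs) = table_step v (table vs)"
  by (cases v) (simp add: table_def upt_rec eval_nat_numeral)

lemma table_energy_table: "table_energy W (table vs) = energy W vs"
  by (cases W) (simp add: table_def energy_def upt_rec eval_nat_numeral)

text \<open>Either the head is used and stays available, or it is dropped for good, so each multiset
  is visited once and common prefixes share their state.\<close>

fun all_multisets :: "('s \<Rightarrow> bool) \<Rightarrow> ('v \<Rightarrow> 's \<Rightarrow> 's) \<Rightarrow> nat \<Rightarrow> 'v list \<Rightarrow> 's \<Rightarrow> bool" where
  "all_multisets Q f 0 vs s = Q s"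
| "all_multisets Q f (Suc n) [] s = True"
| "all_multisets Q f (Suc n) (v # vs) s = (all_multisets Q f n (v # vs) (f v s) \<and> all_multisets Q f (Suc n) vs s)"

text \<open>By symmetry of \<open>energy\<close>, an occurrence of the head \<open>v\<close> in
  \<open>xs\<close> can be moved next to \<open>us\<close>, the vertices already absorbed in the
  state.\<close>

lemma energy_nonneg_if_all_multisets:
  assumes "all_multisets (\<lambda>s. 0 \<le> table_energy W s) table_step n vs s" "s = table us"
    and "set xs \<subseteq> set vs" "length xs = n"
  shows "0 \<le> energy W (xs @ us)"
  using assms
proof (induction "\<lambda>s. 0 \<le> table_energy W s" table_step n vs s arbitrary: us xs rule: all_multisets.induct)
  case (3 n v vs)
  show ?case
  proof (cases "v \<in> set xs")
    case True
    then obtain ys zs where xs: "xs = ys @ v # zs"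
      by (meson split_list)
    have "0 \<le> energy W ((ys @ zs) @ v # us)"
      using 3 xs by (intro "3.hyps"(1)) (auto simp: table_Cons)
    then show ?thesis
      by (cases W) (simp add: xs energy_def mixed_esym_move_to_front
        mixed_esym_move_to_front[of _ _ "ys @ zs", simplified])
  next
    case False
    then have "set xs \<subseteq> set vs"
      using 3 by auto
    then show ?thesis
      using 3 by (intro "3.hyps"(2)) auto
  qed
qed (auto simp: table_energy_table)

text \<open>The denominators are 3^8, 3^4 * 9 and 9^2; the factors 1, 9 and 81 raise all to 6561, so
  the vertex check runs on integers.\<close>

lemma energy_scale:
  "energy (of_int A, of_int B, of_int C, of_int K) (map descale vs)
     = of_int (energy (A, 9 * B, 81 * C, 6561 * K) vs) / 6561"
  by (simp add: energy_def mixed_esym_scale field_simps)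

section \<open>Chromatic numbers\<close>

text \<open>The lattice is shrunk by \<open>sqrt 8\<close> and placed on \<open>n\<close> of the
  coordinate axes, so a bound found in dimension \<open>n\<close> holds in all higher ones.\<close>

lemma lattice_embedding:
  assumes "n \<le> CARD('n)"
  obtains \<phi> :: "(nat \<Rightarrow> int) \<Rightarrow> real ^ 'n"
  where "\<And>x y. (\<Sum>l<n. (x l - y l)\<^sup>2) = 8 \<Longrightarrow> unit_distance (\<phi> x) (\<phi> y)"
proof -
  obtain h :: "nat \<Rightarrow> 'n" where h: "inj_on h {..<n}"
    using inj_on_iff_card_le[of "{..<n}" "UNIV :: 'n set"] assms by auto
  define \<phi> :: "(nat \<Rightarrow> int) \<Rightarrow> real ^ 'n"
    where "\<phi> x = (\<Sum>l<n. (of_int (x l) / sqrt 8) *\<^sub>R axis (h l) 1)" for x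
  have "unit_distance (\<phi> x) (\<phi> y)" if xy: "(\<Sum>l<n. (x l - y l)\<^sup>2) = 8" for x y
  proof -
    have "\<phi> x - \<phi> y = (\<Sum>l<n. (of_int (x l - y l) / sqrt 8) *\<^sub>R axis (h l) 1)"
      by (simp add: \<phi>_def sum_subtractf[symmetric] scaleR_diff_left[symmetric] diff_divide_distrib)
    then have "(\<phi> x - \<phi> y) \<bullet> (\<phi> x - \<phi> y) = (\<Sum>l<n. \<Sum>m<n.
        of_int (x l - y l) / sqrt 8 * (of_int (x m - y m) / sqrt 8) * (if h m = h l then 1 else 0))"
      by (simp add: inner_sum_left inner_sum_right inner_axis_axis sum_distrib_left mult.assoc cong: if_cong)
    also have "\<dots> = (\<Sum>l<n. \<Sum>m<n. if l = m then (of_int (x l - y l))\<^sup>2 / 8 else 0)"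
      using h by (intro sum.cong refl) (auto simp: inj_on_eq_iff power2_eq_square)
    also have "\<dots> = of_int (\<Sum>l<n. (x l - y l)\<^sup>2) / 8"
      by (simp add: sum_divide_distrib)
    finally show ?thesis
      by (simp add: xy unit_distance_def dist_norm norm_eq_sqrt_inner)
  qed
  then show ?thesis
    by (rule that)
qed

lemma chromatic_number_ge_Suc:
  fixes A B C K total :: int
  assumes n: "n \<le> CARD('n)"
    and check: "all_multisets (\<lambda>s. 0 \<le> table_energy (A, 9 * B, 81 * C, 6561 * K) s) table_step n pentagon (table [])"
    and total: "energy (A, B, C, K) (replicate n (1, 1)) = total"
    and less: "int k * K * (int M + 2) ^ n < total * int M ^ n" and "M > 0" "K \<ge> 0"
  shows "enat (Suc k) \<le> chromatic_number (UNIV :: (real ^ 'n) set) unit_distance"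
  unfolding chromatic_number_def
proof (rule Inf_greatest, clarsimp simp: Suc_le_eq)
  fix k' and f :: "real ^ 'n \<Rightarrow> nat"
  assume f: "proper_coloring UNIV unit_distance k' f"
  obtain \<phi> :: "(nat \<Rightarrow> int) \<Rightarrow> real ^ 'n"
    where \<phi>: "\<And>x y. (\<Sum>l<n. (x l - y l)\<^sup>2) = 8 \<Longrightarrow> unit_distance (\<phi> x) (\<phi> y)"
    using lattice_embedding[OF n] by blast
  let ?W = "(of_int A, of_int B, of_int C, of_int K) :: real \<times> real \<times> real \<times> real"
  define L where "L = map (Pair (real_of_int A)) (shapes 8 0 n) @ map (Pair (real_of_int B)) (shapes 4 1 n)
      @ map (Pair (real_of_int C)) (shapes 0 2 n)"
  have sum_L: "of_int K + (\<Sum>i<length L. fst (L ! i) * (\<Prod>l<n. cos (real (snd (L ! i) ! l) * \<theta> l)))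
      = energy ?W (map (\<lambda>l. (cos (\<theta> l), cos (2 * \<theta> l))) [0..<n])" for \<theta>
  proof -
    have "(\<Sum>i<length L. fst (L ! i) * (\<Prod>l<n. cos (real (snd (L ! i) ! l) * \<theta> l)))
        = (\<Sum>e\<leftarrow>L. fst e * (\<Prod>l<n. cos (real (snd e ! l) * \<theta> l)))"
      by (simp add: sum_list_sum_nth atLeast0LessThan)
    also have "\<dots> = of_int A * (\<Sum>t\<leftarrow>shapes 8 0 n. \<Prod>l<n. cos (real (t ! l) * \<theta> l))
        + of_int B * (\<Sum>t\<leftarrow>shapes 4 1 n. \<Prod>l<n. cos (real (t ! l) * \<theta> l))
        + of_int C * (\<Sum>t\<leftarrow>shapes 0 2 n. \<Prod>l<n. cos (real (t ! l) * \<theta> l))"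
      by (simp add: L_def comp_def sum_list_const_mult)
    finally show ?thesis
      by (simp add: sum_shapes_prod_cos energy_def)
  qed
  have vertices: "0 \<le> energy ?W vs" if "set vs \<subseteq> descale ` set pentagon" "length vs = n" for vs
  proof -
    have "vs \<in> map descale ` lists (set pentagon)"
      unfolding lists_image[symmetric] unfolding lists_eq_set using that by simp
    then obtain us where us: "vs = map descale us" "set us \<subseteq> set pentagon"
      by auto
    then show ?thesis
      using energy_nonneg_if_all_multisets[OF check refl us(2)] that by (simp add: energy_scale)
  qed
  have pos: "0 \<le> energy ?W (map (\<lambda>l. (cos (\<theta> l), cos (2 * \<theta> l))) [0..<n])" for \<theta>
  proof -
    have "0 \<le> energy ?W ([] @ map (\<lambda>c. (c, 2 * c\<^sup>2 - 1)) (map (\<lambda>l. cos (\<theta> l)) [0..<n]))"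
      by (rule energy_nonneg_on_parabola[OF vertices]) auto
    then show ?thesis
      by (simp add: cos_double_cos comp_def)
  qed
  have L: "length (snd e) = n \<and> set (snd e) \<subseteq> {0, 1, 2} \<and> (\<Sum>l<n. (snd e ! l)\<^sup>2) = 8" if "e \<in> set L" for e
    using that by (auto simp: L_def dest!: shapes_props)
  have "(of_int K + (\<Sum>i<length L. fst (L ! i))) * real M ^ n \<le> real k' * of_int K * real (M + 2) ^ n"
  proof (rule spectral_colouring_bound[where s = "\<lambda>i l. snd (L ! i) ! l" and col = "\<lambda>x. f (\<phi> x)"])
    fix i l assume i: "i \<in> {..<length L}" and "l < n"
    then have "snd (L ! i) ! l \<in> {0, 1, 2}"
      using L[of "L ! i"] by (metis lessThan_iff nth_mem subsetD)
    then show "snd (L ! i) ! l \<le> 2"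
      by auto
  next
    fix i x y assume i: "i \<in> {..<length L}" and xy: "\<And>l. l < n \<Longrightarrow> \<bar>x l - y l\<bar> = int (snd (L ! i) ! l)"
    have "(\<Sum>l<n. (x l - y l)\<^sup>2) = (\<Sum>l<n. \<bar>x l - y l\<bar>\<^sup>2)"
      by simp
    also have "\<dots> = int (\<Sum>l<n. (snd (L ! i) ! l)\<^sup>2)"
      by (simp add: xy)
    also have "\<dots> = 8"
      using L[of "L ! i"] i by simp
    finally show "f (\<phi> x) \<noteq> f (\<phi> y)"
      using \<phi> f by (simp add: proper_coloring_def)
  qed (use f pos sum_L \<open>M > 0\<close> in \<open>auto simp: proper_coloring_def\<close>)
  also have "of_int K + (\<Sum>i<length L. fst (L ! i)) = energy ?W (replicate n (1, 1))"
    using sum_L[of "\<lambda>_. 0"] by (simp add: map_replicate_const)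
  also have "\<dots> = of_int total"
    \<comment> \<open>Scaling by 1 serves as the coercion from integers to reals.\<close>
    using mixed_esym_scale[of 1 1 _ _ "replicate n (1, 1)"] by (simp add: energy_def flip: total)
  finally have "total * int M ^ n \<le> int k' * K * (int M + 2) ^ n"
    by (simp add: add.commute flip: of_int_le_iff[where ?'a = real])
  with less have "int k * (K * (int M + 2) ^ n) < int k' * (K * (int M + 2) ^ n)"
    by (simp add: mult.assoc)
  then show "k < k'"
    using \<open>K \<ge> 0\<close> by (simp add: mult_less_cancel_right)
qed

text \<open>The weights below are rounded solutions of the linear program that maximises the ratio of
  the total weight to \<open>K\<close> over the vertex constraints.\<close>

lemma chromatic_number_ge_21:
  assumes "8 \<le> CARD('n)"
  shows "21 \<le> chromatic_number (UNIV :: (real ^ 'n) set) unit_distance"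
proof -
  have "enat (Suc 20) \<le> chromatic_number (UNIV :: (real ^ 'n) set) unit_distance"
  \<comment> \<open>The ratio 715 / 35 is about 20.43; \<open>M = 1000\<close> costs a factor
    1.002^8, about 1.016, and stays above 20.\<close>
  proof (rule chromatic_number_ge_Suc[where A = 64 and B = 2 and C = 2 and K = 35 and M = 1000, OF assms])
    show "all_multisets (\<lambda>s. 0 \<le> table_energy (64, 9 * 2, 81 * 2, 6561 * 35) s) table_step 8 pentagon (table [])"
      by code_simp
    show "energy (64, 2, 2, 35) (replicate 8 (1, 1)) = (715 :: int)"
      unfolding table_energy_table[symmetric] by code_simp
  qed simp_all
  then show ?thesis
    by (simp add: numeral_eq_enat)
qed

lemma chromatic_number_ge_32:
  assumes "10 \<le> CARD('n)"
  shows "32 \<le> chromatic_number (UNIV :: (real ^ 'n) set) unit_distance"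
proof -
  have "enat (Suc 31) \<le> chromatic_number (UNIV :: (real ^ 'n) set) unit_distance"
  proof (rule chromatic_number_ge_Suc[where A = 14 and B = 1 and C = 2 and K = 60 and M = 1000, OF assms])
    show "all_multisets (\<lambda>s. 0 \<le> table_energy (14, 9 * 1, 81 * 2, 6561 * 60) s) table_step 10 pentagon (table [])"
      by code_simp
    show "energy (14, 1, 2, 60) (replicate 10 (1, 1)) = (2040 :: int)"
      unfolding table_energy_table[symmetric] by code_simp
  qed simp_all
  then show ?thesis
    by (simp add: numeral_eq_enat)
qed

theorem mainTheorem1:
  shows "chromatic_number (UNIV :: (real ^ 8) set) unit_distance \<ge> 19
       \<and> chromatic_number (UNIV :: (real ^ 9) set) unit_distance \<ge> 21
       \<and> chromatic_number (UNIV :: (real ^ 10) set) unit_distance \<ge> 26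
       \<and> chromatic_number (UNIV :: (real ^ 11) set) unit_distance \<ge> 32
       \<and> chromatic_number (UNIV :: (real ^ 12) set) unit_distance \<ge> 32"
proof (intro conjI)
  show "chromatic_number (UNIV :: (real ^ 8) set) unit_distance \<ge> 19"
    using chromatic_number_ge_21[where 'n = 8] by (rule order_trans[rotated]) simp_all
  show "chromatic_number (UNIV :: (real ^ 10) set) unit_distance \<ge> 26"
    using chromatic_number_ge_32[where 'n = 10] by (rule order_trans[rotated]) simp_all
qed (simp_all add: chromatic_number_ge_21 chromatic_number_ge_32)

end
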